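(* Let $\mathcal{A}$ be a unital Banach algebra and let $a,b,c,d\in\mathcal{A}$ satisfy $acd=dbd$ and $dba=aca$. Put $\alpha=1-ac$ and $\beta=1-bd$. Then $\alpha$ is left regular if and only if $\beta$ is left regular; and $\alpha$ is right regular if and only if $\beta$ is right regular.
   Context: An element $a\in\mathcal{A}$ is left regular if there exists $x\in\mathcal{A}$ with $xa^2=a$, and right regular if there exists $x\in\mathcal{A}$ with $a^2x=a$. *)

theory Defs
  imports Complex_Main
begin

definition left_regular :: "'a::monoid_mult \<Rightarrow> bool"
  where "left_regular a \<longleftrightarrow> (\<exists>x. x * a\<^sup>2 = a)"

definition right_regular :: "'a::monoid_mult \<Rightarrow> bool"
  where "right_regular a \<longleftrightarrow> (\<exists>x. a\<^sup>2 * x = a)"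

end

theory Submission
  imports Defs
begin

text \<open>
  The argument is pure ring theory and passes from \<open>1 - a * c\<close> to \<open>1 - b * d\<close> through the
  intermediate element \<open>1 - d * b\<close>.

  Between \<open>1 - d * b\<close> and \<open>1 - b * d\<close>, regularity transfers in the style of Jacobson's lemma: a
  witness \<open>x\<close> for one yields \<open>1 + b * x * d\<close> for the other, because \<open>d\<close> intertwines the
  two elements, \<open>(1 - d * b) * d = d * (1 - b * d)\<close>, and so does \<open>b\<close> in the opposite direction.

  Between \<open>p = 1 - a * c\<close> and \<open>q = 1 - d * b\<close>, the two hypotheses say that \<open>d * b\<close> and \<open>a * c\<close>
  have the same effect when multiplied from the left onto \<open>d\<close> or \<open>a\<close>. Consequently their
  difference \<open>e = q - p = a * c - d * b\<close> kills \<open>a\<close> and \<open>d\<close>, so that \<open>e * p = e\<close> and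
  \<open>e * e = 0\<close>. Thus \<open>q = (1 + e) * p\<close> is a square-zero perturbation of \<open>p\<close>, and a witness for
  \<open>p\<close> can be corrected explicitly by terms in \<open>e\<close>. The relation is symmetric (replace \<open>e\<close> by
  \<open>- e\<close>), which gives both directions.
\<close>

text \<open>
  Moving \<open>d\<close> across gives \<open>d * (1 - b * d)\<^sup>2 = (1 - d * b)\<^sup>2 * d\<close>. Multiplying by \<open>b * x\<close> from the
  left therefore turns \<open>(1 - b * d)\<^sup>2\<close> into \<open>b * (1 - d * b) * d = (1 - b * d) - (1 - b * d)\<^sup>2\<close>,
  and the last square is absorbed by the summand \<open>1\<close> of the new witness.
\<close>

lemma left_regular_one_minus_commute_imp:
  fixes b d :: "'a::ring_1"
  assumes "left_regular (1 - d * b)"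
  shows "left_regular (1 - b * d)"
proof -
  obtain x where x: "x * (1 - d * b)\<^sup>2 = 1 - d * b"
    using assms by (auto simp: left_regular_def)
  have "(b * x * d) * (1 - b * d)\<^sup>2 = b * (x * (1 - d * b)\<^sup>2) * d"
    by (simp add: power2_eq_square algebra_simps)
  also have "\<dots> = (1 - b * d) - (1 - b * d)\<^sup>2"
    unfolding x by (simp add: power2_eq_square algebra_simps)
  finally have "(1 + b * x * d) * (1 - b * d)\<^sup>2 = 1 - b * d"
    by (simp add: distrib_right)
  then show ?thesis
    unfolding left_regular_def by blast
qed

lemma right_regular_one_minus_commute_imp:
  fixes b d :: "'a::ring_1"
  assumes "right_regular (1 - d * b)"
  shows "right_regular (1 - b * d)"
proof -
  obtain x where x: "(1 - d * b)\<^sup>2 * x = 1 - d * b"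
    using assms by (auto simp: right_regular_def)
  have "(1 - b * d)\<^sup>2 * (b * x * d) = b * ((1 - d * b)\<^sup>2 * x) * d"
    by (simp add: power2_eq_square algebra_simps)
  also have "\<dots> = (1 - b * d) - (1 - b * d)\<^sup>2"
    unfolding x by (simp add: power2_eq_square algebra_simps)
  finally have "(1 - b * d)\<^sup>2 * (1 + b * x * d) = 1 - b * d"
    by (simp add: distrib_left)
  then show ?thesis
    unfolding right_regular_def by blast
qed

lemma left_regular_one_minus_commute:
  fixes b d :: "'a::ring_1"
  shows "left_regular (1 - d * b) \<longleftrightarrow> left_regular (1 - b * d)"
  using left_regular_one_minus_commute_imp by blast

lemma right_regular_one_minus_commute:
  fixes b d :: "'a::ring_1"
  shows "right_regular (1 - d * b) \<longleftrightarrow> right_regular (1 - b * d)"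
  using right_regular_one_minus_commute_imp by blast

lemma square_add_square_zero:
  fixes p e :: "'a::ring_1"
  assumes "e * p = e" and "e * e = 0"
  shows "(p + e)\<^sup>2 = p\<^sup>2 + p * e + e"
  using assms by (simp add: power2_eq_square algebra_simps)

text \<open>
  The left ideal generated by \<open>(p + e)\<^sup>2\<close> contains \<open>e = e * (p + e)\<^sup>2\<close>, hence every multiple of
  \<open>e\<close>. Modulo such multiples \<open>(p + e)\<^sup>2\<close> is \<open>p\<^sup>2\<close>, so \<open>x\<close> brings \<open>p\<close> into this left ideal, and
  with it \<open>p + e\<close>.
\<close>

lemma left_regular_add_square_zero:
  fixes p e :: "'a::ring_1"
  assumes ep: "e * p = e" and ee: "e * e = 0" and "left_regular p"
  shows "left_regular (p + e)"
proof -
  obtain x where x: "x * p\<^sup>2 = p"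
    using assms(3) by (auto simp: left_regular_def)
  note sq = square_add_square_zero[OF ep ee]
  have e_sq: "e * (p + e)\<^sup>2 = e"
  proof -
    have "e * (p + e)\<^sup>2 = e * p * p + e * p * e + e * e"
      unfolding sq by (simp add: power2_eq_square algebra_simps)
    then show ?thesis
      by (simp add: ep ee)
  qed
  \<comment> \<open>As \<open>x * (p + e)\<^sup>2 = p + (x * p + x) * e\<close>, the excess over \<open>p + e\<close> is \<open>(x * p + x - 1) * e\<close>.\<close>
  have "(x - (x * p + x - 1) * e) * (p + e)\<^sup>2
      = x * (p + e)\<^sup>2 - (x * p + x - 1) * (e * (p + e)\<^sup>2)"
    by (simp only: left_diff_distrib mult.assoc)
  also have "\<dots> = x * (p\<^sup>2 + p * e + e) - (x * p + x - 1) * e"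
    unfolding e_sq unfolding sq by (rule refl)
  also have "\<dots> = x * p\<^sup>2 + e"
    by (simp add: algebra_simps)
  also have "\<dots> = p + e"
    by (simp only: x)
  finally show ?thesis
    unfolding left_regular_def by blast
qed

text \<open>
  On this side the witness \<open>x\<close> of \<open>p\<close> is fixed by \<open>e\<close>: \<open>e = e * p = e * p\<^sup>2 * x = e * x\<close>. Hence
  \<open>(p + e)\<^sup>2 * x = (p + e) + p * e\<close>, and the factor \<open>1 - e\<close> in the new witness \<open>x * (1 - e)\<close>
  removes the excess \<open>p * e\<close>.
\<close>

lemma right_regular_add_square_zero:
  fixes p e :: "'a::ring_1"
  assumes ep: "e * p = e" and ee: "e * e = 0" and "right_regular p"
  shows "right_regular (p + e)"
proof -
  obtain x where x: "p\<^sup>2 * x = p"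
    using assms(3) by (auto simp: right_regular_def)
  have "e * x = e * p * p * x"
    by (simp add: ep)
  also have "\<dots> = e * (p\<^sup>2 * x)"
    by (simp only: power2_eq_square mult.assoc)
  finally have ex: "e * x = e"
    by (simp add: x ep)
  have "(p + e)\<^sup>2 * x = p\<^sup>2 * x + p * (e * x) + e * x"
    unfolding square_add_square_zero[OF ep ee] by (simp add: algebra_simps)
  then have "(p + e)\<^sup>2 * x = p + p * e + e"
    by (simp only: x ex)
  then have "(p + e)\<^sup>2 * (x * (1 - e)) = (p + p * e + e) * (1 - e)"
    by (simp only: mult.assoc[symmetric])
  also have "\<dots> = p + e"
    using ee by (simp add: algebra_simps)
  finally show ?thesis
    unfolding right_regular_def by blast
qed

theorem theorem3p1:
  fixes a b c d :: "'a::{real_normed_algebra_1, banach}"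
  assumes "a * c * d = d * b * d"
    and "d * b * a = a * c * a"
  shows "(left_regular (1 - a * c) \<longleftrightarrow> left_regular (1 - b * d)) \<and>
         (right_regular (1 - a * c) \<longleftrightarrow> right_regular (1 - b * d))"
proof -
  define p where "p = 1 - a * c"
  define q where "q = 1 - d * b"
  define e where "e = a * c - d * b"
  have ea: "e * a = 0" and ed: "e * d = 0"
    using assms by (simp_all add: e_def left_diff_distrib)
  have "e * p = e - e * a * c" and "e * q = e - e * d * b"
    by (simp_all add: p_def q_def algebra_simps)
  then have ep: "e * p = e" and eq: "e * q = e"
    by (simp_all add: ea ed)
  have "e * e = e * a * c - e * d * b"
    by (subst (2) e_def) (simp add: algebra_simps)
  then have ee: "e * e = 0"
    by (simp add: ea ed)
  have q: "q = p + e" and p: "p = q + (- e)"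
    by (simp_all add: p_def q_def e_def)
  have neg: "- e * q = - e" "- e * - e = 0"
    by (simp_all add: eq ee)
  have "left_regular p \<longleftrightarrow> left_regular q"
    using left_regular_add_square_zero[OF ep ee] left_regular_add_square_zero[OF neg]
    by (metis p q)
  moreover have "right_regular p \<longleftrightarrow> right_regular q"
    using right_regular_add_square_zero[OF ep ee] right_regular_add_square_zero[OF neg]
    by (metis p q)
  ultimately show ?thesis
    unfolding p_def q_def
    by (simp only: left_regular_one_minus_commute right_regular_one_minus_commute)
qed

end
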